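(* Let $\mathcal{E}$ be a Hilbert $K(\mathcal{H})$-module and let $x, y \in \mathcal{E}$. If $\langle x, y \rangle$ is a normal element, then the following statements are equivalent: (i) $x\| y$; (ii) $\| \langle x, y \rangle\| = \| x\|\| y\|$; (iii) $\theta_{x,x} \| \theta_{y,y}$; (iv) there exist a sequence $\{x_n\}$ of basic vectors in $\mathcal{E}$, with $\langle x_n,x_n\rangle=\xi_n\otimes\xi_n$ for unit vectors $\xi_n\in\mathcal{H}$ ($n\in\mathbb{N}$), and some $\lambda\in\mathbb{T}$ such that $$\lim_n [\langle x_n, x \rangle \langle x, y \rangle \langle y , x_n \rangle \xi_n , \xi_n ] = \lambda\| x\|^2 \| y\|^2.$$
   Context: $(\mathcal{H}, [\cdot,\cdot])$ is a complex Hilbert space and $K(\mathcal{H})$ is the $C^*$-algebra of compact linear operators on $\mathcal{H}$. A (left) Hilbert $\mathcal{A}$-module over a $C^*$-algebra $\mathcal{A}$ is a left $\mathcal{A}$-module with an $\mathcal{A}$-valued inner product $\langle\cdot,\cdot\rangle$, linear in the first variable and conjugate linear in the second, such that $\langle tx,y\rangle=t\langle x,y\rangle$ for $t\in\mathcal{A}$, $\langle x,y\rangle^*=\langle y,x\rangle$, $\langle x,x\rangle\ge 0$ with equality iff $x=0$, and which is complete for the norm $\|x\|=\|\langle x,x\rangle\|^{1/2}$. For $x,y\in\mathcal{E}$, $\theta_{x,y}:\mathcal{E}\to\mathcal{E}$ is $\theta_{x,y}(z)=\langle z,y\rangle x$, considered in the space $\mathcal{L}(\mathcal{E})$ of adjointable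 maps with the operator norm. For $\xi,\eta\in\mathcal{H}$, $\xi\otimes\eta$ is the operator $\nu\mapsto[\nu,\eta]\xi$. A projection $e\in K(\mathcal{H})$ is minimal if $eB(\mathcal{H})e=\mathbb{C}e$, equivalently $e=\xi\otimes\xi$ for a unit vector $\xi\in\mathcal{H}$. A vector $x\in\mathcal{E}$ is basic if $\langle x,x\rangle$ is a minimal projection. Norm-parallelism: for elements $x,y$ of a complex normed space, $x\|y$ means $\|x+\lambda y\|=\|x\|+\|y\|$ for some $\lambda\in\mathbb{T}=\{\alpha\in\mathbb{C}:|\alpha|=1\}$.
   Formalization: The module E is assumed to be nonzero: for E = {0} statements (i)–(iii) hold with x = y = 0, but (iv) fails because E has no basic vectors. *)

theory Defs
  imports "HOL-Analysis.Analysis"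
begin

section \<open>Complex normed spaces and norm-parallelism\<close>

class complex_normed_vector = real_normed_vector +
  fixes scaleC :: "complex \<Rightarrow> 'a \<Rightarrow> 'a" (infixr "*\<^sub>C" 75)
  assumes scaleC_add_right: "c *\<^sub>C (x + y) = c *\<^sub>C x + c *\<^sub>C y"
    and scaleC_add_left: "(c + d) *\<^sub>C x = c *\<^sub>C x + d *\<^sub>C x"
    and scaleC_scaleC: "c *\<^sub>C d *\<^sub>C x = (c * d) *\<^sub>C x"
    and scaleC_one: "1 *\<^sub>C x = x"
    and scaleC_of_real: "complex_of_real r *\<^sub>C x = r *\<^sub>R x"
    and norm_scaleC: "norm (c *\<^sub>C x) = cmod c * norm x"

definition norm_parallel :: "'a::complex_normed_vector \<Rightarrow> 'a \<Rightarrow> bool" (infix "\<parallel>\<^sub>n" 50)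
  where "x \<parallel>\<^sub>n y \<longleftrightarrow> (\<exists>l::complex. cmod l = 1 \<and> norm (x + l *\<^sub>C y) = norm x + norm y)"

lemma bounded_linear_scaleC_right: "bounded_linear (\<lambda>x::'a::complex_normed_vector. c *\<^sub>C x)"
proof (rule bounded_linear_intro)
  fix x y :: 'a and r :: real
  show "c *\<^sub>C (x + y) = c *\<^sub>C x + c *\<^sub>C y" by (rule scaleC_add_right)
  show "c *\<^sub>C r *\<^sub>R x = r *\<^sub>R c *\<^sub>C x"
    by (simp add: scaleC_of_real[symmetric] scaleC_scaleC mult.commute)
  show "norm (c *\<^sub>C x) \<le> norm x * cmod c" by (simp add: norm_scaleC)
qed

text \<open>Complex scaling on operators with values in a complex normed space; the norm of
  \<open>'a \<Rightarrow>\<^sub>L 'b\<close> is the operator norm.  Elements of \<open>'a \<Rightarrow>\<^sub>L 'b\<close> are only real-linear, and complex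
  linearity is imposed separately where it is needed.\<close>

instantiation blinfun :: (real_normed_vector, complex_normed_vector) complex_normed_vector
begin

lift_definition scaleC_blinfun :: "complex \<Rightarrow> ('a \<Rightarrow>\<^sub>L 'b) \<Rightarrow> ('a \<Rightarrow>\<^sub>L 'b)"
  is "\<lambda>c T x. c *\<^sub>C T x"
  by (rule bounded_linear_compose[OF bounded_linear_scaleC_right])

instance
proof
  fix c d :: complex and r :: real and S T :: "'a \<Rightarrow>\<^sub>L 'b"
  show "c *\<^sub>C (S + T) = c *\<^sub>C S + c *\<^sub>C T" by transfer (simp add: scaleC_add_right)
  show "(c + d) *\<^sub>C T = c *\<^sub>C T + d *\<^sub>C T" by transfer (simp add: scaleC_add_left)
  show "c *\<^sub>C d *\<^sub>C T = (c * d) *\<^sub>C T" by transfer (simp add: scaleC_scaleC)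
  show "1 *\<^sub>C T = T" by transfer (simp add: scaleC_one)
  show "complex_of_real r *\<^sub>C T = r *\<^sub>R T" by transfer (simp add: scaleC_of_real)
  show "norm (c *\<^sub>C T) = cmod c * norm T"
  proof transfer
    fix c :: complex and T :: "'a \<Rightarrow> 'b"
    assume T: "bounded_linear T"
    have le: "onorm (\<lambda>x. c *\<^sub>C S x) \<le> cmod c * onorm S" if S: "bounded_linear S" for c and S :: "'a \<Rightarrow> 'b"
    proof (rule onorm_bound)
      show "0 \<le> cmod c * onorm S" by (simp add: onorm_pos_le[OF S])
      show "norm (c *\<^sub>C S x) \<le> cmod c * onorm S * norm x" for x :: 'a
        using mult_left_mono[OF onorm[OF S], of "cmod c" x] by (simp add: norm_scaleC mult.assoc)
    qed
    show "onorm (\<lambda>x. c *\<^sub>C T x) = cmod c * onorm T"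
    proof (cases "c = 0")
      case True
      then have "(\<lambda>x. c *\<^sub>C T x) = (\<lambda>x. 0)"
        using norm_scaleC[of 0] by auto
      then show ?thesis using True by (simp add: onorm_zero)
    next
      case False
      have cT: "bounded_linear (\<lambda>x. c *\<^sub>C T x)"
        by (rule bounded_linear_compose[OF bounded_linear_scaleC_right T])
      have "onorm T = onorm (\<lambda>x. inverse c *\<^sub>C c *\<^sub>C T x)"
        using False by (simp add: scaleC_scaleC scaleC_one)
      also have "\<dots> \<le> inverse (cmod c) * onorm (\<lambda>x. c *\<^sub>C T x)"
        using le[OF cT, of "inverse c"] by (simp add: norm_inverse)
      finally have "cmod c * onorm T \<le> onorm (\<lambda>x. c *\<^sub>C T x)"
        using False by (simp add: field_simps)
      with le[OF T, of c] show ?thesis by simp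
    qed
  qed
qed

end


section \<open>Operators on a complex Hilbert space\<close>

class chilbert_space = complex_normed_vector + banach +
  fixes cinner :: "'a \<Rightarrow> 'a \<Rightarrow> complex"
  assumes cinner_add_left: "cinner (x + y) z = cinner x z + cinner y z"
    and cinner_scaleC_left: "cinner (c *\<^sub>C x) y = c * cinner x y"
    and cinner_commute: "cinner x y = cnj (cinner y x)"
    and cinner_ge_zero: "0 \<le> Re (cinner x x)"
    and cinner_eq_zero_iff: "cinner x x = 0 \<longleftrightarrow> x = 0"
    and norm_eq_sqrt_cinner: "norm x = sqrt (Re (cinner x x))"

type_synonym 'h operator = "'h \<Rightarrow>\<^sub>L 'h"

definition bounded_operators :: "'h::chilbert_space operator set"
  where "bounded_operators = {T :: 'h operator. \<forall>c x. T (c *\<^sub>C x) = c *\<^sub>C T x}"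

definition compact_operators :: "'h::chilbert_space operator set"
  where "compact_operators = {T \<in> bounded_operators. compact (closure (T ` cball 0 1))}"

definition is_adjoint :: "'h::chilbert_space operator \<Rightarrow> 'h operator \<Rightarrow> bool"
  where "is_adjoint T S \<longleftrightarrow> (\<forall>u v. cinner (T u) v = cinner u (S v))"

definition adj :: "'h::chilbert_space operator \<Rightarrow> 'h operator"
  where "adj T = (THE S. is_adjoint T S)"

definition normal_operator :: "'h::chilbert_space operator \<Rightarrow> bool"
  where "normal_operator T \<longleftrightarrow> T o\<^sub>L adj T = adj T o\<^sub>L T"

definition positive_operator :: "'h::chilbert_space operator \<Rightarrow> bool"
  where "positive_operator T \<longleftrightarrow> (\<forall>u. cinner (T u) u \<in> \<real>\<^sub>\<ge>\<^sub>0)"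

definition rank_one :: "'h::chilbert_space \<Rightarrow> 'h \<Rightarrow> 'h operator" (infix "\<otimes>\<^sub>H" 70)
  where "\<xi> \<otimes>\<^sub>H \<eta> = Blinfun (\<lambda>\<nu>. cinner \<nu> \<eta> *\<^sub>C \<xi>)"

text \<open>The condition \<open>e \<noteq> 0\<close> is explicit because \<open>0\<close> also satisfies \<open>e B(H) e = \<complex> e\<close>.\<close>

definition minimal_projection :: "'h::chilbert_space operator \<Rightarrow> bool"
  where "minimal_projection e \<longleftrightarrow>
    e \<in> compact_operators \<and> e o\<^sub>L e = e \<and> is_adjoint e e \<and> e \<noteq> 0 \<and>
    {e o\<^sub>L T o\<^sub>L e | T. T \<in> bounded_operators} = {c *\<^sub>C e | c. True}"

lemma cinner_add_right: "cinner x (y + z) = cinner x y + cinner (x::'h::chilbert_space) z"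
  using cinner_commute[of x "y + z"] cinner_commute[of x y] cinner_commute[of x z]
  by (simp add: cinner_add_left)

lemma cinner_scaleC_right: "cinner x (c *\<^sub>C y) = cnj c * cinner (x::'h::chilbert_space) y"
  using cinner_commute[of x "c *\<^sub>C y"] cinner_commute[of x y]
  by (simp add: cinner_scaleC_left)

lemma cinner_diff_right: "cinner x (y - z) = cinner x y - cinner (x::'h::chilbert_space) z"
  using cinner_add_right[of x "y - z" z] by simp

lemma cinner_self: "cinner x x = complex_of_real ((norm (x::'h::chilbert_space))\<^sup>2)"
proof -
  have "Im (cinner x x) = 0"
    using cinner_commute[of x x] by (simp add: complex_eq_iff)
  then show ?thesis
    by (simp add: complex_eq_iff norm_eq_sqrt_cinner cinner_ge_zero)
qed

lemma cinner_Cauchy_Schwarz: "cmod (cinner x y) \<le> norm x * norm (y::'h::chilbert_space)"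
proof (cases "y = 0")
  case True
  have "cinner x 0 = 0" using cinner_add_right[of x 0 0] by simp
  with True show ?thesis by simp
next
  case False
  then have ny: "norm y > 0" by simp
  define a where "a = cinner x y"
  define k where "k = - a / complex_of_real ((norm y)\<^sup>2)"
  define z where "z = x + k *\<^sub>C y"
  have yx: "cinner y x = cnj a" unfolding a_def by (rule cinner_commute)
  have k: "k * complex_of_real ((norm y)\<^sup>2) = - a" using ny by (simp add: k_def)
  have "cinner z z = cinner x x + cnj k * a + k * cnj a + k * cnj k * cinner y y"
    by (simp add: z_def cinner_add_left cinner_add_right cinner_scaleC_left cinner_scaleC_right
        a_def[symmetric] yx algebra_simps)
  also have "k * cnj k * cinner y y = - cnj k * a"
    unfolding cinner_self using k by (metis mult.assoc mult.commute mult_minus_left)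
  finally have "cinner z z = cinner x x + k * cnj a" by simp
  also have "k * cnj a = - complex_of_real ((cmod a)\<^sup>2 / (norm y)\<^sup>2)"
    by (simp add: k_def complex_norm_square[of a, simplified])
  finally have "complex_of_real ((norm z)\<^sup>2)
      = complex_of_real ((norm x)\<^sup>2 - (cmod a)\<^sup>2 / (norm y)\<^sup>2)"
    by (simp add: cinner_self)
  then have "(norm z)\<^sup>2 = (norm x)\<^sup>2 - (cmod a)\<^sup>2 / (norm y)\<^sup>2"
    by (simp only: of_real_eq_iff)
  then have "(cmod a)\<^sup>2 / (norm y)\<^sup>2 \<le> (norm x)\<^sup>2"
    by (smt (verit) zero_le_power2)
  then have "(cmod a)\<^sup>2 \<le> (norm x * norm y)\<^sup>2"
    using ny by (simp add: field_simps power_mult_distrib)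
  then show ?thesis unfolding a_def by (rule power2_le_imp_le) simp
qed

lemma rank_one_apply: "(\<xi> \<otimes>\<^sub>H \<eta>) \<nu> = cinner \<nu> \<eta> *\<^sub>C \<xi>"
proof -
  have "bounded_linear (\<lambda>\<nu>. cinner \<nu> \<eta> *\<^sub>C \<xi>)"
  proof (rule bounded_linear_intro)
    fix x y :: 'a and r :: real
    show "cinner (x + y) \<eta> *\<^sub>C \<xi> = cinner x \<eta> *\<^sub>C \<xi> + cinner y \<eta> *\<^sub>C \<xi>"
      by (simp add: cinner_add_left scaleC_add_left)
    show "cinner (r *\<^sub>R x) \<eta> *\<^sub>C \<xi> = r *\<^sub>R cinner x \<eta> *\<^sub>C \<xi>"
      by (simp add: scaleC_of_real[symmetric] cinner_scaleC_left scaleC_scaleC)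
    show "norm (cinner x \<eta> *\<^sub>C \<xi>) \<le> norm x * (norm \<eta> * norm \<xi>)"
      using mult_right_mono[OF cinner_Cauchy_Schwarz[of x \<eta>], of "norm \<xi>"]
      by (simp add: norm_scaleC mult.assoc)
  qed
  then show ?thesis by (simp add: rank_one_def bounded_linear_Blinfun_apply)
qed

lemma is_adjoint_unique:
  assumes "is_adjoint T S" "is_adjoint T S'"
  shows "S = S'"
proof (rule blinfun_eqI)
  fix v
  have "cinner u (S v - S' v) = 0" for u
    using assms unfolding is_adjoint_def cinner_diff_right by (metis right_minus_eq)
  then show "S v = S' v" using cinner_eq_zero_iff[of "S v - S' v"] by simp
qed

lemma adj_eqI: "is_adjoint T S \<Longrightarrow> adj T = S"
  unfolding adj_def using is_adjoint_unique by blast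

lemma is_adjoint_sym: "is_adjoint T S \<Longrightarrow> is_adjoint S T"
  unfolding is_adjoint_def by (metis cinner_commute)

lemma is_adjoint_norm_le:
  assumes "is_adjoint T S"
  shows "norm (S u) \<le> norm T * norm u"
proof (cases "S u = 0")
  case False
  have "complex_of_real ((norm (S u))\<^sup>2) = cinner (T (S u)) u"
    using assms by (simp add: is_adjoint_def cinner_self)
  then have "(norm (S u))\<^sup>2 = cmod (cinner (T (S u)) u)"
    by (metis abs_of_nonneg norm_of_real zero_le_power2)
  also have "\<dots> \<le> norm (T (S u)) * norm u" by (rule cinner_Cauchy_Schwarz)
  also have "\<dots> \<le> norm T * norm (S u) * norm u"
    by (intro mult_right_mono norm_blinfun) simp
  finally have "norm (S u) * norm (S u) \<le> norm (S u) * (norm T * norm u)"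
    by (simp add: power2_eq_square mult_ac)
  with False show ?thesis by simp
qed simp


lemma blinfun_compose_compose: "(R o\<^sub>L S) o\<^sub>L T = R o\<^sub>L (S o\<^sub>L T)"
  by (rule blinfun_eqI) simp


section \<open>Hilbert modules over the compact operators\<close>

text \<open>Both \<open>act\<close> and \<open>ip\<close> are total functions on the type of operators; the module is over
  \<^term>\<open>compact_operators\<close>, so \<open>act\<close> is meaningful only there and \<open>ip\<close> takes values there.
  Completeness is part of the sort of \<open>'e\<close>, whose norm is tied to \<open>ip\<close> by \<open>norm_eq\<close>.\<close>

locale compact_hilbert_module =
  fixes act :: "'h::chilbert_space operator \<Rightarrow> 'e::{complex_normed_vector,banach} \<Rightarrow> 'e"
    and ip :: "'e \<Rightarrow> 'e \<Rightarrow> 'h operator"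
  assumes act_add_right: "T \<in> compact_operators \<Longrightarrow> act T (x + y) = act T x + act T y"
    and act_add_left: "\<lbrakk>S \<in> compact_operators; T \<in> compact_operators\<rbrakk> \<Longrightarrow>
          act (S + T) x = act S x + act T x"
    and act_act: "\<lbrakk>S \<in> compact_operators; T \<in> compact_operators\<rbrakk> \<Longrightarrow>
          act (S o\<^sub>L T) x = act S (act T x)"
    and act_scaleC_left: "T \<in> compact_operators \<Longrightarrow> act (c *\<^sub>C T) x = c *\<^sub>C act T x"
    and act_scaleC_right: "T \<in> compact_operators \<Longrightarrow> act T (c *\<^sub>C x) = c *\<^sub>C act T x"
    and ip_compact: "ip x y \<in> compact_operators"
    and ip_add_left: "ip (x + y) z = ip x z + ip y z"
    and ip_scaleC_left: "ip (c *\<^sub>C x) y = c *\<^sub>C ip x y"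
    and ip_add_right: "ip x (y + z) = ip x y + ip x z"
    and ip_scaleC_right: "ip x (c *\<^sub>C y) = cnj c *\<^sub>C ip x y"
    and ip_act: "T \<in> compact_operators \<Longrightarrow> ip (act T x) y = T o\<^sub>L ip x y"
    and ip_adjoint: "is_adjoint (ip x y) (ip y x)"
    and ip_positive: "positive_operator (ip x x)"
    and ip_eq_zero_iff: "ip x x = 0 \<longleftrightarrow> x = 0"
    and norm_eq: "norm x = sqrt (norm (ip x x))"

definition theta :: "('h::chilbert_space operator \<Rightarrow> 'e \<Rightarrow> 'e) \<Rightarrow> ('e \<Rightarrow> 'e \<Rightarrow> 'h operator) \<Rightarrow>
    'e \<Rightarrow> 'e \<Rightarrow> 'e::{complex_normed_vector,banach} \<Rightarrow>\<^sub>L 'e"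
  where "theta act ip x y = Blinfun (\<lambda>z. act (ip z y) x)"

definition basic_vector :: "('e \<Rightarrow> 'e \<Rightarrow> 'h::chilbert_space operator) \<Rightarrow> 'e \<Rightarrow> bool"
  where "basic_vector ip x \<longleftrightarrow> minimal_projection (ip x x)"

context compact_hilbert_module
begin

lemma norm_ip_self: "norm (ip x x) = (norm x)\<^sup>2"
  by (simp add: norm_eq)

lemma ip_act_right:
  assumes T: "T \<in> compact_operators" and adj: "is_adjoint T S"
  shows "ip x (act T y) = ip x y o\<^sub>L S"
proof (rule is_adjoint_unique)
  show "is_adjoint (ip (act T y) x) (ip x (act T y))" by (rule ip_adjoint)
  show "is_adjoint (ip (act T y) x) (ip x y o\<^sub>L S)"
    using adj ip_adjoint[of y x] by (simp add: ip_act[OF T] is_adjoint_def)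
qed

lemma norm_act_ip_le: "norm (act (ip z y) x) \<le> norm (ip z y) * norm x"
proof -
  let ?T = "ip z y" and ?S = "ip y z"
  have "ip (act ?T x) (act ?T x) = ?T o\<^sub>L (ip x x o\<^sub>L ?S)"
    by (simp only: ip_act[OF ip_compact] ip_act_right[OF ip_compact ip_adjoint] blinfun_compose_compose)
  then have "(norm (act ?T x))\<^sup>2 = norm (?T o\<^sub>L (ip x x o\<^sub>L ?S))"
    by (simp add: norm_ip_self[symmetric])
  also have "\<dots> \<le> norm ?T * (norm (ip x x) * norm ?S)"
    by (meson mult_left_mono norm_blinfun_compose norm_ge_zero order_trans)
  also have "\<dots> \<le> norm ?T * (norm (ip x x) * norm ?T)"
    by (intro mult_left_mono norm_ge_zero
        norm_blinfun_bound[OF norm_ge_zero is_adjoint_norm_le[OF ip_adjoint]])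
  finally have "(norm (act ?T x))\<^sup>2 \<le> (norm ?T * norm x)\<^sup>2"
    by (simp add: norm_ip_self power2_eq_square mult_ac)
  then show ?thesis by (rule power2_le_imp_le) simp
qed

lemma norm_ip_le: "norm (ip x y) \<le> norm x * norm y"
proof (cases "y = 0")
  case True
  then show ?thesis using ip_add_right[of x 0 0] by simp
next
  case False
  then have ny: "norm y > 0" by simp
  let ?T = "ip x y" and ?S = "ip y x"
  define s where "s = inverse ((norm y)\<^sup>2)"
  define w where "w = act ?T y"
  have sy: "s > 0" "s * (norm y)\<^sup>2 = 1" using ny by (simp_all add: s_def)
  have ww: "ip w w = ?T o\<^sub>L (ip y y o\<^sub>L ?S)" and wx: "ip w x = ?T o\<^sub>L ?S" and xw: "ip x w = ?T o\<^sub>L ?S"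
    by (simp_all only: w_def ip_act[OF ip_compact] ip_act_right[OF ip_compact ip_adjoint]
        blinfun_compose_compose)
  have "norm (?S u) \<le> norm x * norm y * norm u" for u
  proof -
    let ?k = "- complex_of_real s"
    let ?z = "x + ?k *\<^sub>C w"
    have "ip ?z ?z = ip x x + ?k *\<^sub>C ip x w + ?k *\<^sub>C ip w x + (?k * ?k) *\<^sub>C ip w w"
      by (simp add: ip_add_left ip_add_right ip_scaleC_left ip_scaleC_right scaleC_scaleC
          scaleC_add_right)
    then have "cinner (ip ?z ?z u) u = cinner (ip x x u) u + ?k * cinner (ip x w u) u
        + ?k * cinner (ip w x u) u + ?k * ?k * cinner (ip w w u) u"
      by (simp add: blinfun.add_left scaleC_blinfun.rep_eq cinner_add_left cinner_scaleC_left)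
    moreover have TS: "cinner (?T v) u = cinner v (?S u)" for v
      using ip_adjoint[of x y] by (simp add: is_adjoint_def)
    ultimately have eq: "cinner (ip ?z ?z u) u = cinner (ip x x u) u
        - 2 * complex_of_real (s * (norm (?S u))\<^sup>2)
        + complex_of_real (s * s) * cinner (ip y y (?S u)) (?S u)"
      by (simp add: ww wx xw cinner_self)
    have "0 \<le> Re (cinner (ip ?z ?z u) u)"
      using ip_positive[of ?z] unfolding positive_operator_def complex_nonneg_Reals_iff by blast
    then have 1: "2 * (s * (norm (?S u))\<^sup>2) \<le> Re (cinner (ip x x u) u)
        + s * s * Re (cinner (ip y y (?S u)) (?S u))"
      unfolding eq by simp
    have 2: "Re (cinner (ip a a v) v) \<le> (norm a)\<^sup>2 * (norm v)\<^sup>2" for a v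
    proof -
      have "Re (cinner (ip a a v) v) \<le> cmod (cinner (ip a a v) v)" by (rule complex_Re_le_cmod)
      also have "\<dots> \<le> norm (ip a a v) * norm v" by (rule cinner_Cauchy_Schwarz)
      also have "\<dots> \<le> norm (ip a a) * norm v * norm v"
        by (intro mult_right_mono norm_blinfun) simp
      finally show ?thesis by (simp add: norm_ip_self power2_eq_square mult.assoc)
    qed
    have "s * s * Re (cinner (ip y y (?S u)) (?S u)) \<le> s * s * ((norm y)\<^sup>2 * (norm (?S u))\<^sup>2)"
      using 2 sy by (intro mult_left_mono) auto
    also have "\<dots> = s * (s * (norm y)\<^sup>2) * (norm (?S u))\<^sup>2"
      by (simp only: mult_ac)
    finally have "s * s * Re (cinner (ip y y (?S u)) (?S u)) \<le> s * (norm (?S u))\<^sup>2"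
      by (simp add: sy)
    with 1 2[of x u] have "s * (norm (?S u))\<^sup>2 \<le> (norm x)\<^sup>2 * (norm u)\<^sup>2" by linarith
    then have "(norm y)\<^sup>2 * (s * (norm (?S u))\<^sup>2) \<le> (norm y)\<^sup>2 * ((norm x)\<^sup>2 * (norm u)\<^sup>2)"
      by (rule mult_left_mono) simp
    moreover have "(norm y)\<^sup>2 * (s * (norm (?S u))\<^sup>2) = (norm (?S u))\<^sup>2"
      using sy by (metis mult.assoc mult.commute mult_1)
    ultimately have "(norm (?S u))\<^sup>2 \<le> (norm y)\<^sup>2 * ((norm x)\<^sup>2 * (norm u)\<^sup>2)" by simp
    then have "(norm (?S u))\<^sup>2 \<le> (norm x * norm y * norm u)\<^sup>2"
      by (simp only: power_mult_distrib mult_ac)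
    then show ?thesis by (rule power2_le_imp_le) simp
  qed
  then have "norm ?S \<le> norm x * norm y" by (intro norm_blinfun_bound) auto
  moreover have "norm ?T \<le> norm ?S"
    by (rule norm_blinfun_bound[OF norm_ge_zero is_adjoint_norm_le[OF ip_adjoint]])
  ultimately show ?thesis by simp
qed

lemma theta_apply: "theta act ip x y z = act (ip z y) x"
proof -
  have "bounded_linear (\<lambda>z. act (ip z y) x)"
  proof (rule bounded_linear_intro)
    fix z z' :: 'e and r :: real
    show "act (ip (z + z') y) x = act (ip z y) x + act (ip z' y) x"
      by (simp add: ip_add_left act_add_left ip_compact)
    show "act (ip (r *\<^sub>R z) y) x = r *\<^sub>R act (ip z y) x"
      by (simp add: scaleC_of_real[symmetric] ip_scaleC_left act_scaleC_left ip_compact)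
    show "norm (act (ip z y) x) \<le> norm z * (norm y * norm x)"
      using norm_act_ip_le[of z y x] mult_right_mono[OF norm_ip_le[of z y], of "norm x"]
      by (simp add: mult.assoc)
  qed
  then show ?thesis by (simp add: theta_def bounded_linear_Blinfun_apply)
qed

lemma ip_theta: "ip (theta act ip x y z) w = ip z (theta act ip y x w)"
  by (simp only: theta_apply ip_act[OF ip_compact] ip_act_right[OF ip_compact ip_adjoint])

end

end

theory Submission
  imports Defs
begin

text \<open>
  Write \<open>a = \<parallel>x\<parallel>\<close>, \<open>b = \<parallel>y\<parallel>\<close>, \<open>T = \<langle>x,y\<rangle>\<close>; always \<open>\<parallel>T\<parallel> \<le> ab\<close>.  Each of the other three conditions
  forces \<open>\<parallel>T\<parallel> = ab\<close>, because the only way to make the norm in question as large as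
  it can be is through a cross term that \<open>\<parallel>T\<parallel>\<close> controls.  For parallelism this is
  \<open>\<parallel>p + q\<parallel>\<^sup>2 \<le> \<parallel>p\<parallel>\<^sup>2 + \<parallel>q\<parallel>\<^sup>2 + 2\<parallel>\<langle>p,q\<rangle>\<parallel>\<close>, applied to \<open>x\<close> and \<open>\<lambda>y\<close> or to the images of
  a vector \<open>z\<close> under \<open>\<theta>\<close> (\<open>norm_parallel_imp_norm_ip\<close>, \<open>theta_parallel_imp_norm_ip\<close>); for the
  sequence of basic vectors, which have norm one, it is the bound
  \<open>\<parallel>\<langle>z,x\<rangle> T \<langle>y,z\<rangle>\<parallel> \<le> ab\<parallel>T\<parallel>\<parallel>z\<parallel>\<^sup>2\<close> (\<open>basic_sequence_imp_norm_ip\<close>).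

  Normality and compactness serve the converse.  A nonzero compact normal operator has a unit
  eigenvector \<open>u\<close> whose eigenvalue \<open>\<mu>\<close> has modulus \<open>\<parallel>T\<parallel>\<close>, and \<open>u\<close> is then also an eigenvector of
  \<open>T*\<close> (\<open>compact_normal_eigenvector\<close>).  If \<open>\<parallel>T\<parallel> = ab > 0\<close>, then in the semi-inner product
  \<open>(p,q) \<mapsto> [\<langle>p,q\<rangle>u,u]\<close>, in which \<open>x\<close> and \<open>y\<close> have lengths at most \<open>a\<close> and \<open>b\<close>, there is equality
  in the Cauchy-Schwarz inequality.  Hence \<open>\<langle>x,x\<rangle>u = a\<^sup>2u\<close>, \<open>\<langle>y,y\<rangle>u = b\<^sup>2u\<close>, and with
  \<open>e = u \<otimes> u\<close> the vectors \<open>ex\<close> and \<open>ey\<close> are proportional (\<open>norm_attaining_eigenvector\<close>).  Everything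
  is now witnessed by explicit vectors: \<open>x + (\<mu>/\<bar>\<mu>\<bar>)y\<close> attains norm \<open>a + b\<close> at \<open>u\<close>;
  \<open>ex\<close> is an eigenvector of \<open>\<theta>\<^sub>x\<^sub>,\<^sub>x\<close> and of \<open>\<theta>\<^sub>y\<^sub>,\<^sub>y\<close> with eigenvalues \<open>a\<^sup>2\<close> and \<open>b\<^sup>2\<close>, so that their
  sum has norm \<open>a\<^sup>2 + b\<^sup>2\<close>; and \<open>ex/a\<close> is a basic vector which, as a constant sequence, gives the
  limit with \<open>\<lambda> = 1\<close>.
\<close>

section \<open>Sesquilinear algebra\<close>

lemma scaleC_zero_left: "0 *\<^sub>C x = (0::'a::complex_normed_vector)"
  using norm_scaleC[of 0 x] by simp

lemma scaleC_minus_left: "(- c) *\<^sub>C x = - (c *\<^sub>C (x::'a::complex_normed_vector))"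
  using scaleC_add_left[of c "-c" x] by (simp add: scaleC_zero_left eq_neg_iff_add_eq_0 add.commute)

lemma cinner_zero_left: "cinner 0 (x::'h::chilbert_space) = 0"
  using cinner_add_left[of 0 0 x] by simp

lemma cinner_diff_left: "cinner (x - y) z = cinner x z - cinner y (z::'h::chilbert_space)"
  using cinner_add_left[of "x - y" y z] by simp

lemma cinner_scaleR_left: "cinner (r *\<^sub>R x) y = r * cinner x (y::'h::chilbert_space)"
  by (simp add: scaleC_of_real[symmetric] cinner_scaleC_left)

lemma cinner_scaleR_right: "cinner x (r *\<^sub>R y) = r * cinner x (y::'h::chilbert_space)"
  by (simp add: scaleC_of_real[symmetric] cinner_scaleC_right)

lemma bounded_bilinear_cinner: "bounded_bilinear (cinner :: 'h::chilbert_space \<Rightarrow> 'h \<Rightarrow> complex)"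
  by (rule bounded_bilinear.intro)
    (auto simp: cinner_add_left cinner_add_right cinner_scaleR_left cinner_scaleR_right
      scaleR_conv_of_real intro!: exI[of _ 1] cinner_Cauchy_Schwarz)

lemma cinner_eq_ext:
  assumes "\<And>w. cinner u w = cinner v w"
  shows "u = (v::'h::chilbert_space)"
  using assms[of "u - v"] cinner_eq_zero_iff[of "u - v"] by (simp add: cinner_diff_left)

lemma cinner_self_Re: "Re (cinner x x) = (norm (x::'h::chilbert_space))\<^sup>2"
  by (simp add: cinner_self)

lemma Re_cinner_commute: "Re (cinner x y) = Re (cinner y (x::'h::chilbert_space))"
  by (subst cinner_commute) simp

lemma norm_add_scaleR_squared:
  "(norm (x + r *\<^sub>R y))\<^sup>2 = (norm x)\<^sup>2 + 2 * r * Re (cinner x y) + r\<^sup>2 * (norm (y::'h::chilbert_space))\<^sup>2"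
  using Re_cinner_commute[of x y]
  unfolding cinner_self_Re[symmetric]
  by (simp add: cinner_add_left cinner_add_right cinner_scaleR_left cinner_scaleR_right
      algebra_simps power2_eq_square)

text \<open>Elements of the operator type are only real-linear; the existence of an adjoint makes them
  complex-linear.\<close>

lemma is_adjoint_scaleC:
  assumes "is_adjoint T S"
  shows "T (c *\<^sub>C x) = c *\<^sub>C T x"
  using assms by (intro cinner_eq_ext) (simp add: is_adjoint_def cinner_scaleC_left)

text \<open>This is how eigenvectors are recognised below: the two bounds leave no room in
  \<open>\<parallel>v - cu\<parallel>\<^sup>2 = \<parallel>v\<parallel>\<^sup>2 - 2c Re [v,u] + c\<^sup>2\<parallel>u\<parallel>\<^sup>2\<close>.  For \<open>u \<noteq> 0\<close> the first of them also forces \<open>c \<ge> 0\<close>.\<close>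

lemma Cauchy_Schwarz_equality:
  assumes "norm v \<le> c * norm u" and "c * (norm u)\<^sup>2 \<le> Re (cinner v u)"
  shows "v = c *\<^sub>R (u::'h::chilbert_space)"
proof -
  have "(norm (v - c *\<^sub>R u))\<^sup>2 = (norm v)\<^sup>2 - 2 * c * Re (cinner v u) + c\<^sup>2 * (norm u)\<^sup>2"
    using norm_add_scaleR_squared[of v "- c" u] by simp
  moreover have "(norm v)\<^sup>2 \<le> c\<^sup>2 * (norm u)\<^sup>2"
    using power_mono[OF assms(1), of 2] by (simp add: power_mult_distrib)
  moreover have "c * (c * (norm u)\<^sup>2) \<le> c * Re (cinner v u)" if "u \<noteq> 0"
    using assms that
    by (intro mult_left_mono) (auto, smt (verit) norm_ge_zero mult_nonpos_nonneg zero_less_norm_iff mult_neg_pos)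
  ultimately have "(norm (v - c *\<^sub>R u))\<^sup>2 \<le> 0"
    by (cases "u = 0") (use assms in \<open>auto simp: power2_eq_square algebra_simps\<close>)
  then show ?thesis by simp
qed

section \<open>Eigenvectors of compact normal operators\<close>

text \<open>The Rayleigh quotient attains its maximum \<open>m\<close> on the unit sphere of \<open>V\<close>.  Then \<open>m - H\<close> is
  positive on \<open>V\<close> and its quadratic form vanishes at the maximiser, which is therefore in the
  kernel.  Allowing an invariant subspace \<open>V\<close> makes it possible to diagonalise commuting operators
  one after the other.\<close>

lemma selfadjoint_eigenvector_of_compact_sphere:
  fixes H :: "'h::chilbert_space operator"
  assumes H: "is_adjoint H H"
    and V: "\<And>u v. u \<in> V \<Longrightarrow> v \<in> V \<Longrightarrow> u + v \<in> V" "\<And>c v. v \<in> V \<Longrightarrow> c *\<^sub>C v \<in> V"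
    and HV: "\<And>v. v \<in> V \<Longrightarrow> H v \<in> V"
    and comp: "compact (V \<inter> sphere 0 1)" and ne: "V \<inter> sphere 0 1 \<noteq> {}"
  obtains v m where "v \<in> V" "norm v = 1" "H v = m *\<^sub>R v"
proof -
  define f where "f v = Re (cinner (H v) v)" for v
  have "continuous_on (V \<inter> sphere 0 1) f"
    unfolding f_def
    by (intro continuous_intros bounded_bilinear.continuous_on[OF bounded_bilinear_cinner])
  from continuous_attains_sup[OF comp ne this]
  obtain v where v: "v \<in> V" "norm v = 1" and max: "\<And>w. w \<in> V \<Longrightarrow> norm w = 1 \<Longrightarrow> f w \<le> f v"
    by auto
  define m where "m = f v"
  have VR: "r *\<^sub>R w \<in> V" if "w \<in> V" for r w
    using V(2)[OF that, of "of_real r"] by (simp add: scaleC_of_real)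
  have le: "f w \<le> m * (norm w)\<^sup>2" if "w \<in> V" for w
  proof (cases "w = 0")
    case False
    have "f (inverse (norm w) *\<^sub>R w) \<le> m"
      unfolding m_def using False that by (intro max VR) auto
    then show ?thesis using False
      by (simp add: f_def blinfun.scaleR_right cinner_scaleR_left cinner_scaleR_right field_simps power2_eq_square)
  qed (simp add: f_def cinner_zero_left)
  \<comment> \<open>The residual \<open>w\<close> is the direction in which the quotient would increase if \<open>w \<noteq> 0\<close>.\<close>
  define w where "w = H v - m *\<^sub>R v"
  have w: "w \<in> V"
    unfolding w_def using V(1)[OF HV[OF v(1)] VR[OF v(1), of "-m"]] by simp
  define q where "q = m * (norm w)\<^sup>2 - f w"
  define s where "s = (norm w)\<^sup>2"
  have q: "q \<ge> 0" using le[OF w] by (simp add: q_def)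
  have HH: "cinner (H a) b = cinner a (H b)" for a b using H by (simp add: is_adjoint_def)
  have sw: "Re (cinner (H v) w) - m * Re (cinner v w) = s"
    unfolding s_def cinner_self_Re[symmetric] by (subst (3) w_def) (simp add: cinner_diff_left cinner_scaleR_left)
  have ineq: "2 * t * s \<le> t\<^sup>2 * q" for t
  proof -
    have 1: "f (v + t *\<^sub>R w) = f v + 2 * t * Re (cinner (H v) w) + t\<^sup>2 * f w"
    proof -
      have "Re (cinner (H w) v) = Re (cinner (H v) w)"
        unfolding HH by (subst cinner_commute) (simp add: HH)
      then show ?thesis
        by (simp add: f_def blinfun.add_right blinfun.scaleR_right cinner_add_left cinner_add_right
          cinner_scaleR_left cinner_scaleR_right algebra_simps power2_eq_square)
    qed
    have 2: "(norm (v + t *\<^sub>R w))\<^sup>2 = 1 + 2 * t * Re (cinner v w) + t\<^sup>2 * (norm w)\<^sup>2"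
      using norm_add_scaleR_squared[of v t w] v by simp
    have "f (v + t *\<^sub>R w) \<le> m * (norm (v + t *\<^sub>R w))\<^sup>2"
      by (intro le V(1) VR v w)
    then have "2 * t * (Re (cinner (H v) w) - m * Re (cinner v w)) \<le> t\<^sup>2 * q"
      unfolding 1 2 q_def by (simp add: m_def algebra_simps)
    then show ?thesis unfolding sw .
  qed
  have "s = 0"
  proof (rule ccontr)
    assume "s \<noteq> 0"
    then have s: "s > 0" by (simp add: s_def)
    \<comment> \<open>A step so short that the first-order gain beats the second-order loss \<open>q\<close>;
      the summand 1 covers \<open>q = 0\<close>.\<close>
    define t where "t = s / (q + 1)"
    have t: "t > 0" "t * q = s - t" using s q by (simp_all add: t_def field_simps)
    have "t * (2 * s) \<le> t * (t * q)" using ineq[of t] by (simp add: power2_eq_square mult_ac)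
    then have "2 * s \<le> t * q" using t by simp
    then show False using s t by simp
  qed
  then have "H v = m *\<^sub>R v" by (simp add: s_def w_def)
  with v that show thesis by blast
qed

text \<open>The norm attains its maximum on the compact closure of the image of the unit ball, and the
  maximum is \<open>\<parallel>T\<parallel>\<close>.  The maximiser \<open>w\<close> itself is an eigenvector of \<open>TT*\<close>: as a limit of vectors
  \<open>T u\<^sub>n\<close> with \<open>\<parallel>u\<^sub>n\<parallel> \<le> 1\<close> it satisfies \<open>\<parallel>w\<parallel>\<^sup>2 \<le> \<parallel>T*w\<parallel>\<close>, which forces equality in
  \<open>[TT*w,w] \<le> \<parallel>TT*w\<parallel> \<parallel>w\<parallel>\<close>.  Working with \<open>w\<close> avoids extracting a convergent subsequence of
  the \<open>u\<^sub>n\<close>.\<close>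

lemma compact_operator_singular_vector:
  fixes T :: "'h::chilbert_space operator"
  assumes T: "T \<in> compact_operators" and S: "is_adjoint T S"
  obtains w where "norm w = norm T" "T (S w) = (norm T)\<^sup>2 *\<^sub>R w"
proof -
  let ?C = "closure (T ` cball 0 1)"
  have "compact ?C" using T by (simp add: compact_operators_def)
  then obtain w where w: "w \<in> ?C" and max: "\<And>v. v \<in> ?C \<Longrightarrow> norm v \<le> norm w"
    using continuous_attains_sup[of ?C norm] by (auto intro: continuous_intros)
  have S': "norm (S u) \<le> norm T * norm u" for u by (rule is_adjoint_norm_le[OF S])
  have "norm (T u) \<le> norm w * norm u" for u
  proof (cases "u = 0")
    case False
    have "T (inverse (norm u) *\<^sub>R u) \<in> ?C"
      using False by (intro subsetD[OF closure_subset] imageI) simp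
    from max[OF this] show ?thesis
      using False by (simp add: blinfun.scaleR_right field_simps)
  qed simp
  then have 1: "norm T \<le> norm w" by (intro norm_blinfun_bound) auto
  obtain p where p: "\<And>n. p n \<in> T ` cball 0 1" "p \<longlonglongrightarrow> w"
    using w unfolding closure_sequential by blast
  have pn: "norm (p n) \<le> norm T" for n
  proof -
    obtain u where "p n = T u" "norm u \<le> 1" using p(1)[of n] by auto
    then show ?thesis
      using norm_blinfun[of T u] mult_left_mono[of "norm u" 1 "norm T"] by simp
  qed
  have nw: "norm w = norm T"
    using 1 pn LIMSEQ_le_const2[OF tendsto_norm[OF p(2)], of "norm T"] by auto
  have "cmod (cinner (p n) w) \<le> norm (S w)" for n
  proof -
    obtain u where u: "p n = T u" "norm u \<le> 1" using p(1)[of n] by auto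
    have "cmod (cinner (p n) w) = cmod (cinner u (S w))"
      using S by (simp add: u is_adjoint_def)
    also have "\<dots> \<le> norm u * norm (S w)" by (rule cinner_Cauchy_Schwarz)
    also have "\<dots> \<le> norm (S w)" using u mult_right_mono[of "norm u" 1 "norm (S w)"] by simp
    finally show ?thesis .
  qed
  moreover have "(\<lambda>n. cmod (cinner (p n) w)) \<longlonglongrightarrow> cmod (cinner w w)"
    by (intro tendsto_norm bounded_bilinear.tendsto[OF bounded_bilinear_cinner] p tendsto_const)
  ultimately have "cmod (cinner w w) \<le> norm (S w)"
    using LIMSEQ_le_const2 by blast
  then have Sw: "(norm T)\<^sup>2 \<le> norm (S w)"
    by (simp add: cinner_self nw norm_power)
  have "T (S w) = (norm T)\<^sup>2 *\<^sub>R w"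
  proof (rule Cauchy_Schwarz_equality)
    have "norm (T (S w)) \<le> norm T * (norm T * norm w)"
      using S'[of w] norm_blinfun[of T "S w"] by (meson mult_left_mono norm_ge_zero order_trans)
    then show "norm (T (S w)) \<le> (norm T)\<^sup>2 * norm w"
      by (simp add: power2_eq_square mult.assoc)
    have "((norm T)\<^sup>2)\<^sup>2 \<le> (norm (S w))\<^sup>2" using Sw by (intro power_mono) auto
    also have "\<dots> = Re (cinner (T (S w)) w)"
      using S by (simp add: is_adjoint_def cinner_self)
    finally show "(norm T)\<^sup>2 * (norm w)\<^sup>2 \<le> Re (cinner (T (S w)) w)"
      by (simp add: nw power2_eq_square)
  qed
  with nw that show thesis by blast
qed

text \<open>The eigenspace of \<open>TT*\<close> for \<open>\<parallel>T\<parallel>\<^sup>2\<close> is nonzero, has a compact unit sphere because \<open>T\<close> is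
  compact, and is invariant under \<open>T\<close> and \<open>T*\<close> by normality.  On it the commuting self-adjoint
  operators \<open>T + T*\<close> and \<open>\<i>(T - T*)\<close> have a common eigenvector, which is one of \<open>T\<close> and of \<open>T*\<close>;
  the modulus of the eigenvalue can be read off from \<open>TT*\<close>.\<close>

lemma compact_normal_eigenvector:
  fixes T :: "'h::chilbert_space operator"
  assumes T: "T \<in> compact_operators" and S: "is_adjoint T S"
    and comm: "T o\<^sub>L S = S o\<^sub>L T" and "T \<noteq> 0"
  obtains u \<mu> where "norm u = 1" "T u = \<mu> *\<^sub>C u" "S u = cnj \<mu> *\<^sub>C u" "cmod \<mu> = norm T"
proof -
  define n where "n = norm T"
  have n: "n > 0" using \<open>T \<noteq> 0\<close> by (simp add: n_def)
  have TS: "T (S v) = S (T v)" for v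
    using comm by (metis blinfun_apply_blinfun_compose)
  have Tc: "T (c *\<^sub>C v) = c *\<^sub>C T v" and Sc: "S (c *\<^sub>C v) = c *\<^sub>C S v" for c v
    using is_adjoint_scaleC[OF S] is_adjoint_scaleC[OF is_adjoint_sym[OF S]] by auto
  have Tadj: "cinner (T a) b = cinner a (S b)" and Sadj: "cinner (S a) b = cinner a (T b)" for a b
    using S is_adjoint_sym[OF S] by (auto simp: is_adjoint_def)
  have cR: "c *\<^sub>C (r *\<^sub>R v) = r *\<^sub>R (c *\<^sub>C v)" for c r and v :: 'h
    by (simp add: scaleC_of_real[symmetric] scaleC_scaleC mult.commute)
  define V where "V = {v. T (S v) = n\<^sup>2 *\<^sub>R v}"
  have "closed V" unfolding V_def
    by (intro closed_Collect_eq continuous_intros)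
  \<comment> \<open>On \<open>V\<close> the vector \<open>v\<close> is recovered as \<open>T\<close> of the bounded vector \<open>S v / n\<^sup>2\<close>.\<close>
  have Vsub: "V \<inter> sphere 0 1 \<subseteq> (\<lambda>v. inverse n *\<^sub>R v) ` closure (T ` cball 0 1)"
  proof
    fix v assume "v \<in> V \<inter> sphere 0 1"
    then have v: "T (S v) = n\<^sup>2 *\<^sub>R v" "norm v = 1" by (auto simp: V_def)
    have "norm (inverse n *\<^sub>R S v) \<le> 1"
      using is_adjoint_norm_le[OF S, of v] v n by (simp add: n_def field_simps)
    then have "T (inverse n *\<^sub>R S v) \<in> closure (T ` cball 0 1)"
      by (intro subsetD[OF closure_subset] imageI) simp
    moreover have "v = inverse n *\<^sub>R T (inverse n *\<^sub>R S v)"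
      using v n by (simp add: blinfun.scaleR_right power2_eq_square field_simps)
    ultimately show "v \<in> (\<lambda>v. inverse n *\<^sub>R v) ` closure (T ` cball 0 1)" by blast
  qed
  have comp: "compact (V \<inter> sphere 0 1)"
  proof -
    have "compact ((\<lambda>v. inverse n *\<^sub>R v) ` closure (T ` cball 0 1))"
      using T by (intro compact_continuous_image continuous_intros) (simp add: compact_operators_def)
    moreover have "closed (V \<inter> sphere 0 1)" 
    proof -
      have "sphere (0::'h) 1 = {v. norm v = 1}" by auto
      moreover have "closed {v::'h. norm v = 1}" by (intro closed_Collect_eq continuous_intros)
      ultimately show ?thesis using \<open>closed V\<close> by (simp add: closed_Int)
    qed
    ultimately show ?thesis using Vsub by (metis compact_Int_closed inf.absorb_iff2)
  qed
  have ne: "V \<inter> sphere 0 1 \<noteq> {}"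
  proof -
    obtain w where "norm w = norm T" "T (S w) = (norm T)\<^sup>2 *\<^sub>R w"
      by (rule compact_operator_singular_vector[OF T S])
    then have "inverse n *\<^sub>R w \<in> V \<inter> sphere 0 1"
      using n by (simp add: V_def n_def blinfun.scaleR_right)
    then show ?thesis by blast
  qed
  define H where "H = T + S"
  define K where "K = \<i> *\<^sub>C (T - S)"
  have Ha: "H v = T v + S v" and Ka: "K v = \<i> *\<^sub>C (T v - S v)" for v
    by (simp_all add: H_def K_def blinfun.add_left blinfun.diff_left scaleC_blinfun.rep_eq)
  have Hadj: "is_adjoint H H"
    by (simp add: is_adjoint_def Ha cinner_add_left cinner_add_right Tadj Sadj add.commute)
  have Kadj: "is_adjoint K K"
    by (simp add: is_adjoint_def Ka cinner_scaleC_left cinner_scaleC_right cinner_diff_left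
        cinner_diff_right Tadj Sadj algebra_simps)
  have V1: "u + v \<in> V" if "u \<in> V" "v \<in> V" for u v
    using that by (simp add: V_def blinfun.add_right scaleR_add_right)
  have V2: "c *\<^sub>C v \<in> V" if "v \<in> V" for c v
    using that by (simp add: V_def Tc Sc cR)
  have VT: "T v \<in> V" if "v \<in> V" for v
    using that by (simp add: V_def TS[symmetric] blinfun.scaleR_right)
  have VS: "S v \<in> V" if "v \<in> V" for v
    using that by (simp add: V_def TS blinfun.scaleR_right)
  have VH: "H v \<in> V" if "v \<in> V" for v unfolding Ha by (intro V1 VT VS that)
  have VK: "K v \<in> V" if "v \<in> V" for v
  proof -
    have "T v + (-1) *\<^sub>C S v \<in> V" by (intro V1 V2 VT VS that)
    then show ?thesis unfolding Ka by (intro V2) (simp add: scaleC_minus_left scaleC_one)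
  qed
  obtain v m where v: "v \<in> V" "norm v = 1" "H v = m *\<^sub>R v"
    using selfadjoint_eigenvector_of_compact_sphere[OF Hadj V1 V2 VH comp ne] by blast
  define W where "W = V \<inter> {v. H v = m *\<^sub>R v}"
  have HK: "H (K u) = K (H u)" for u
    by (simp add: Ha Ka Tc Sc blinfun.add_right blinfun.diff_right TS scaleC_add_right[symmetric]) 
  have compW: "compact (W \<inter> sphere 0 1)"
  proof -
    have "closed {v. H v = m *\<^sub>R v}" by (intro closed_Collect_eq continuous_intros)
    then have "compact ((V \<inter> sphere 0 1) \<inter> {v. H v = m *\<^sub>R v})"
      by (intro compact_Int_closed comp)
    then show ?thesis by (simp add: W_def Int_ac)
  qed
  have neW: "W \<inter> sphere 0 1 \<noteq> {}" using v by (auto simp: W_def)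
  have KW: "K w \<in> W" if "w \<in> W" for w
    using that by (auto simp: W_def VK HK blinfun.scaleR_right)
  have W1: "a + b \<in> W" if "a \<in> W" "b \<in> W" for a b
    using that by (auto simp: W_def V1 blinfun.add_right scaleR_add_right)
  have W2: "c *\<^sub>C w \<in> W" if "w \<in> W" for c w
    using that by (auto simp: W_def V2 is_adjoint_scaleC[OF Hadj] cR)
  obtain u k where u: "u \<in> W" "norm u = 1" "K u = k *\<^sub>R u"
    using selfadjoint_eigenvector_of_compact_sphere[OF Kadj W1 W2 KW compW neW] by blast
  define \<mu> where "\<mu> = Complex (m / 2) (- k / 2)"
  have \<mu>: "\<mu> = (m - \<i> * k) / 2" "cnj \<mu> = (m + \<i> * k) / 2"
    by (simp_all add: \<mu>_def complex_eq_iff)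
  have sum: "T u + S u = complex_of_real m *\<^sub>C u"
    using u by (simp add: W_def Ha scaleC_of_real)
  have "\<i> *\<^sub>C (T u - S u) = complex_of_real k *\<^sub>C u"
    using u by (simp add: Ka scaleC_of_real)
  then have "(- \<i>) *\<^sub>C \<i> *\<^sub>C (T u - S u) = (- \<i>) *\<^sub>C complex_of_real k *\<^sub>C u" by simp
  then have diff: "T u - S u = (- \<i> * k) *\<^sub>C u" by (simp add: scaleC_scaleC scaleC_one)
  have half: "a = (1/2) *\<^sub>C (c + d) *\<^sub>C u" if "a + b = c *\<^sub>C u" "a - b = d *\<^sub>C u" for a b c d
  proof -
    have "a + a = (c + d) *\<^sub>C u"
      unfolding scaleC_add_left that[symmetric] by simp
    moreover have "(1/2) *\<^sub>C (a + a) = a"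
      using scaleC_add_left[of "1/2" "1/2" a] by (simp add: scaleC_add_right scaleC_one)
    ultimately show ?thesis by simp
  qed
  have Tu: "T u = \<mu> *\<^sub>C u"
    using half[OF sum diff] by (simp add: scaleC_scaleC \<mu>)
  have "S u + T u = complex_of_real m *\<^sub>C u" "S u - T u = (\<i> * k) *\<^sub>C u"
    using sum diff by (auto simp: add.commute scaleC_minus_left algebra_simps)
  from half[OF this] have Su: "S u = cnj \<mu> *\<^sub>C u"
    by (simp add: scaleC_scaleC \<mu>)
  have "n\<^sup>2 *\<^sub>R u = T (S u)" using u by (simp add: W_def V_def)
  also have "\<dots> = ((cmod \<mu>)\<^sup>2) *\<^sub>R u"
    by (simp add: Su Tc Tu scaleC_scaleC scaleC_of_real[symmetric] complex_norm_square[symmetric]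
        mult.commute[of "cnj \<mu>"])
  finally have "(cmod \<mu>)\<^sup>2 = n\<^sup>2" using u by auto
  then have "cmod \<mu> = n" using n by simp
  with u Tu Su that show thesis unfolding n_def by blast
qed

section \<open>Rank-one projections\<close>

lemma is_adjoint_rank_one_self: "is_adjoint (u \<otimes>\<^sub>H u) (u \<otimes>\<^sub>H u)"
proof -
  have "cinner a u * cinner u b = cnj (cinner b u) * cinner a u" for a b
    by (subst cinner_commute[of u b]) simp
  then show ?thesis
    by (simp add: is_adjoint_def rank_one_apply cinner_scaleC_left cinner_scaleC_right)
qed

lemma rank_one_bounded: "\<xi> \<otimes>\<^sub>H \<eta> \<in> bounded_operators"
  by (simp add: bounded_operators_def rank_one_apply cinner_scaleC_left scaleC_scaleC)

lemma rank_one_compact: "\<xi> \<otimes>\<^sub>H \<eta> \<in> compact_operators"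
proof -
  let ?L = "\<lambda>c::complex. c *\<^sub>C \<xi>"
  have "bounded_linear ?L"
    by (rule bounded_linear_intro[of _ "norm \<xi>"])
      (simp_all add: scaleC_add_left norm_scaleC scaleC_of_real[symmetric] scaleC_scaleC scaleR_conv_of_real)
  then have K: "compact (?L ` cball 0 (norm \<eta>))"
    by (intro compact_continuous_image compact_cball linear_continuous_on)
  have "(\<xi> \<otimes>\<^sub>H \<eta>) ` cball 0 1 \<subseteq> ?L ` cball 0 (norm \<eta>)"
  proof (rule image_subsetI)
    fix \<nu> :: 'a assume "\<nu> \<in> cball 0 1"
    then have "cmod (cinner \<nu> \<eta>) \<le> norm \<eta>"
      using cinner_Cauchy_Schwarz[of \<nu> \<eta>] mult_right_mono[of "norm \<nu>" 1 "norm \<eta>"] by simp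
    then show "(\<xi> \<otimes>\<^sub>H \<eta>) \<nu> \<in> ?L ` cball 0 (norm \<eta>)"
      by (intro image_eqI[of _ _ "cinner \<nu> \<eta>"]) (auto simp: rank_one_apply)
  qed
  then have "closure ((\<xi> \<otimes>\<^sub>H \<eta>) ` cball 0 1) \<subseteq> ?L ` cball 0 (norm \<eta>)"
    by (intro closure_minimal compact_imp_closed K)
  then show ?thesis
    unfolding compact_operators_def
    using rank_one_bounded K by (auto simp: compact_Int_closed inf.absorb_iff2)
       (metis closed_closure compact_Int_closed inf.absorb_iff2)
qed

lemma norm_rank_one_self: "norm (u \<otimes>\<^sub>H u) = (norm u)\<^sup>2"
proof (rule antisym)
  show "norm (u \<otimes>\<^sub>H u) \<le> (norm u)\<^sup>2"
  proof (rule norm_blinfun_bound)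
    fix v show "norm ((u \<otimes>\<^sub>H u) v) \<le> (norm u)\<^sup>2 * norm v"
      using mult_right_mono[OF cinner_Cauchy_Schwarz[of v u] norm_ge_zero[of u]]
      by (simp add: rank_one_apply norm_scaleC power2_eq_square mult_ac)
  qed simp
  show "(norm u)\<^sup>2 \<le> norm (u \<otimes>\<^sub>H u)"
    using norm_blinfun[of "u \<otimes>\<^sub>H u" u]
    by (cases "u = 0") (simp_all add: rank_one_apply norm_scaleC cinner_self norm_power)
qed

lemma rank_one_sandwich:
  assumes "T \<in> bounded_operators"
  shows "(u \<otimes>\<^sub>H u) o\<^sub>L T o\<^sub>L (u \<otimes>\<^sub>H u) = cinner (T u) u *\<^sub>C (u \<otimes>\<^sub>H u)"
  using assms
  by (intro blinfun_eqI) (simp add: bounded_operators_def rank_one_apply scaleC_blinfun.rep_eq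
      cinner_scaleC_left scaleC_scaleC mult.commute)

lemma rank_one_compose_eigenvector:
  assumes "is_adjoint A S" "S u = c *\<^sub>C u"
  shows "(u \<otimes>\<^sub>H u) o\<^sub>L A = cnj c *\<^sub>C (u \<otimes>\<^sub>H u)"
  using assms
  by (intro blinfun_eqI) (simp add: is_adjoint_def rank_one_apply scaleC_blinfun.rep_eq
      cinner_scaleC_right scaleC_scaleC)

lemma minimal_projection_rank_one:
  assumes "norm u = 1"
  shows "minimal_projection (u \<otimes>\<^sub>H u)"
proof -
  let ?e = "u \<otimes>\<^sub>H u"
  have uu: "cinner u u = 1" using assms by (simp add: cinner_self)
  have idem: "?e o\<^sub>L ?e = ?e"
    by (intro blinfun_eqI) (simp add: rank_one_apply cinner_scaleC_left uu)
  have "{?e o\<^sub>L T o\<^sub>L ?e | T. T \<in> bounded_operators} = {c *\<^sub>C ?e | c. True}"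
  proof (intro equalityI subsetI)
    fix A assume "A \<in> {c *\<^sub>C ?e | c. True}"
    then obtain c where A: "A = c *\<^sub>C ?e" by blast
    have "c *\<^sub>C ?e \<in> bounded_operators"
      by (simp add: bounded_operators_def scaleC_blinfun.rep_eq rank_one_apply cinner_scaleC_left
          scaleC_scaleC mult_ac)
    moreover have "?e o\<^sub>L (c *\<^sub>C ?e) o\<^sub>L ?e = A"
      unfolding A rank_one_sandwich[OF calculation]
      by (simp add: scaleC_blinfun.rep_eq rank_one_apply cinner_scaleC_left uu)
    ultimately show "A \<in> {?e o\<^sub>L T o\<^sub>L ?e | T. T \<in> bounded_operators}" by blast
  qed (auto simp: rank_one_sandwich)
  moreover have "?e \<noteq> 0" using norm_rank_one_self[of u] assms by auto
  ultimately show ?thesis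
    by (simp add: minimal_projection_def rank_one_compact idem is_adjoint_rank_one_self)
qed

section \<open>Vector states of a Hilbert module\<close>

context compact_hilbert_module
begin

lemma cinner_ip_self_nonneg: "cinner (ip z z u) u \<in> \<real>\<^sub>\<ge>\<^sub>0"
  using ip_positive[of z] by (simp add: positive_operator_def)

lemma cinner_ip_self_le:
  assumes "norm u = 1"
  shows "Re (cinner (ip z z u) u) \<le> (norm z)\<^sup>2"
proof -
  have "Re (cinner (ip z z u) u) \<le> norm (ip z z u) * norm u"
    using complex_Re_le_cmod cinner_Cauchy_Schwarz order_trans by blast
  also have "\<dots> \<le> (norm z)\<^sup>2"
    using norm_blinfun[of "ip z z" u] assms by (simp add: norm_ip_self)
  finally show ?thesis .
qed

lemma cinner_ip_add_scaleC:
  "Re (cinner (ip (x + c *\<^sub>C y) (x + c *\<^sub>C y) u) u) =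
    Re (cinner (ip x x u) u) + (cmod c)\<^sup>2 * Re (cinner (ip y y u) u) + 2 * Re (cnj c * cinner (ip x y u) u)"
proof -
  have 1: "cinner (ip y x u) u = cnj (cinner (ip x y u) u)"
    using ip_adjoint[of y x] cinner_commute[of u "ip x y u"] by (simp add: is_adjoint_def)
  show ?thesis
    unfolding cmod_power2
    by (simp add: ip_add_left ip_add_right ip_scaleC_left ip_scaleC_right blinfun.add_left
        scaleC_blinfun.rep_eq cinner_add_left cinner_scaleC_left scaleC_add_right scaleC_scaleC 1
        algebra_simps power2_eq_square)
qed

lemma ip_act_rank_one:
  "ip (act (u \<otimes>\<^sub>H u) z) (act (u \<otimes>\<^sub>H u) z) = cinner (ip z z u) u *\<^sub>C (u \<otimes>\<^sub>H u)"
proof -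
  let ?e = "u \<otimes>\<^sub>H u"
  have "ip (act ?e z) (act ?e z) = ?e o\<^sub>L ip z z o\<^sub>L ?e"
    by (simp only: ip_act[OF rank_one_compact] blinfun_compose_compose
      ip_act_right[OF rank_one_compact is_adjoint_rank_one_self])
  also have "\<dots> = cinner (ip z z u) u *\<^sub>C ?e"
    using ip_compact[of z z] by (intro rank_one_sandwich) (auto simp: compact_operators_def)
  finally show ?thesis .
qed

lemma ip_self_eigenvector:
  assumes "norm u = 1" "(norm z)\<^sup>2 \<le> Re (cinner (ip z z u) u)"
  shows "ip z z u = (complex_of_real ((norm z)\<^sup>2)) *\<^sub>C u"
  using Cauchy_Schwarz_equality[of "ip z z u" "(norm z)\<^sup>2" u] norm_blinfun[of "ip z z" u] assms
  by (simp add: norm_ip_self scaleC_of_real del: of_real_power)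

text \<open>Equality in Cauchy-Schwarz for the semi-inner product of the state at \<open>u\<close>: with
  \<open>w = x - (\<mu>/b\<^sup>2)y\<close> the value \<open>[\<langle>w,w\<rangle>u,u]\<close> is nonnegative, but it is
  \<open>[\<langle>x,x\<rangle>u,u] + (a/b)\<^sup>2[\<langle>y,y\<rangle>u,u] - 2a\<^sup>2\<close>, where the first two terms are at most \<open>a\<^sup>2\<close> each.  So all of these
  inequalities are equalities, and \<open>w\<close> is annihilated by the projection onto \<open>u\<close>.\<close>

lemma norm_attaining_eigenvector:
  assumes "x \<noteq> 0" "y \<noteq> 0" and normal: "normal_operator (ip x y)"
    and eq: "norm (ip x y) = norm x * norm y"
  obtains u \<mu> where "norm u = 1" "ip x y u = \<mu> *\<^sub>C u" "ip y x u = cnj \<mu> *\<^sub>C u"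
    "cmod \<mu> = norm x * norm y"
    "ip x x u = (complex_of_real ((norm x)\<^sup>2)) *\<^sub>C u"
    "ip y y u = (complex_of_real ((norm y)\<^sup>2)) *\<^sub>C u"
    "act (u \<otimes>\<^sub>H u) x = (\<mu> / (norm y)\<^sup>2) *\<^sub>C act (u \<otimes>\<^sub>H u) y"
proof -
  define a where "a = norm x"
  define b where "b = norm y"
  have ab: "a > 0" "b > 0" using assms by (auto simp: a_def b_def)
  have "adj (ip x y) = ip y x" by (rule adj_eqI) (rule ip_adjoint)
  then have "ip x y o\<^sub>L ip y x = ip y x o\<^sub>L ip x y"
    using normal by (simp add: normal_operator_def)
  moreover have "ip x y \<noteq> 0" using eq assms by auto
  ultimately obtain u \<mu> where u: "norm u = 1" "ip x y u = \<mu> *\<^sub>C u" "ip y x u = cnj \<mu> *\<^sub>C u"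
    and \<mu>': "cmod \<mu> = norm (ip x y)"
    using compact_normal_eigenvector[OF ip_compact ip_adjoint] by blast
  have \<mu>: "cmod \<mu> = a * b" using \<mu>' eq by (simp add: a_def b_def)
  let ?qx = "Re (cinner (ip x x u) u)" and ?qy = "Re (cinner (ip y y u) u)"
  define c where "c = - \<mu> / complex_of_real (b\<^sup>2)"
  define w where "w = x + c *\<^sub>C y"
  have qw: "Re (cinner (ip w w u) u) = ?qx + (a / b)\<^sup>2 * ?qy - 2 * a\<^sup>2"
  proof -
    have "cmod c = a / b" using ab by (simp add: c_def norm_divide norm_mult \<mu> power2_eq_square)
    moreover have "cnj c * cinner (ip x y u) u = - complex_of_real (a\<^sup>2)"
    proof -
      have "cinner (ip x y u) u = \<mu>" using u by (simp add: cinner_scaleC_left cinner_self)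
      then have "cnj c * cinner (ip x y u) u = - (\<mu> * cnj \<mu>) / complex_of_real (b\<^sup>2)"
        by (simp add: c_def)
      also have "\<mu> * cnj \<mu> = complex_of_real (a\<^sup>2 * b\<^sup>2)"
        by (simp only: complex_norm_square[symmetric] \<mu> power_mult_distrib)
      finally show ?thesis using ab by simp
    qed
    ultimately show ?thesis
      unfolding w_def cinner_ip_add_scaleC by simp
  qed
  have le: "?qx \<le> a\<^sup>2" "?qy \<le> b\<^sup>2"
    using cinner_ip_self_le[OF u(1)] by (auto simp: a_def b_def)
  have pos: "0 \<le> Re (cinner (ip w w u) u)"
    using cinner_ip_self_nonneg[of w u] by (simp add: complex_nonneg_Reals_iff)
  have "(a / b)\<^sup>2 * ?qy \<le> (a / b)\<^sup>2 * b\<^sup>2" by (intro mult_left_mono le) simp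
  also have "\<dots> = a\<^sup>2" using ab by (simp add: power_divide)
  finally have le2: "(a / b)\<^sup>2 * ?qy \<le> a\<^sup>2" .
  have qx: "a\<^sup>2 \<le> ?qx" using pos qw le2 by simp
  have "(a / b)\<^sup>2 * b\<^sup>2 \<le> (a / b)\<^sup>2 * ?qy" using pos qw le ab by (simp add: power_divide)
  then have qy: "b\<^sup>2 \<le> ?qy" using ab by simp
  let ?e = "u \<otimes>\<^sub>H u"
  have "Re (cinner (ip w w u) u) = 0"
    using pos qw le2 le by simp
  then have qw0: "cinner (ip w w u) u = 0"
    using cinner_ip_self_nonneg[of w u] by (simp add: complex_nonneg_Reals_iff complex_eq_iff)
  have "ip (act ?e w) (act ?e w) = 0"
    by (simp add: ip_act_rank_one qw0 scaleC_zero_left)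
  then have "act ?e w = 0" by (simp add: ip_eq_zero_iff)
  then have "act ?e x + c *\<^sub>C act ?e y = 0"
    by (simp add: w_def act_add_right act_scaleC_right rank_one_compact)
  then have "act ?e x = (\<mu> / complex_of_real (b\<^sup>2)) *\<^sub>C act ?e y"
    by (simp add: c_def scaleC_minus_left eq_neg_iff_add_eq_0)
  then show thesis
    using that u \<mu> ip_self_eigenvector[OF u(1)] qx qy by (simp add: a_def b_def)
qed

lemma ip_act_rank_one_self:
  assumes "ip z z u = (complex_of_real ((norm z)\<^sup>2)) *\<^sub>C u" "norm u = 1"
  shows "ip (act (u \<otimes>\<^sub>H u) z) (act (u \<otimes>\<^sub>H u) z) = (complex_of_real ((norm z)\<^sup>2)) *\<^sub>C (u \<otimes>\<^sub>H u)"
  using assms by (simp add: ip_act_rank_one cinner_scaleC_left cinner_self)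

lemma basic_vector_of_eigenvector:
  assumes z: "ip z z u = (complex_of_real ((norm z)\<^sup>2)) *\<^sub>C u" "norm u = 1" "z \<noteq> 0"
  defines "X \<equiv> complex_of_real (1 / norm z) *\<^sub>C act (u \<otimes>\<^sub>H u) z"
  shows "ip X X = u \<otimes>\<^sub>H u" and "basic_vector ip X"
proof -
  show "ip X X = u \<otimes>\<^sub>H u"
    unfolding X_def using z(3)
    by (simp add: ip_scaleC_left ip_scaleC_right scaleC_scaleC ip_act_rank_one_self[OF z(1,2)]
      power2_eq_square scaleC_one)
  then show "basic_vector ip X"
    by (simp add: basic_vector_def minimal_projection_rank_one z)
qed

section \<open>Norm estimates\<close>

text \<open>The cross terms \<open>\<langle>a,b\<rangle>\<close> and \<open>\<langle>b,a\<rangle>\<close> are operators, mutually adjoint; their norms stand in for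
  \<open>2 Re [a,b]\<close> in a Hilbert space.\<close>

lemma norm_add_squared_le: "(norm (a + b))\<^sup>2 \<le> (norm a)\<^sup>2 + (norm b)\<^sup>2 + 2 * norm (ip a b)"
proof -
  have "ip (a + b) (a + b) = ip a a + ip b b + (ip a b + ip b a)"
    by (simp add: ip_add_left ip_add_right)
  then have "(norm (a + b))\<^sup>2 \<le> norm (ip a a) + norm (ip b b) + (norm (ip a b) + norm (ip b a))"
    by (simp add: norm_ip_self[symmetric] norm_triangle_le norm_triangle_mono)
  moreover have "norm (ip b a) \<le> norm (ip a b)"
    by (rule norm_blinfun_bound[OF norm_ge_zero is_adjoint_norm_le[OF ip_adjoint]])
  ultimately show ?thesis by (simp add: norm_ip_self)
qed

lemma norm_ip_sandwich_le:
  "norm (ip z x o\<^sub>L ip x y o\<^sub>L ip y w) \<le> norm z * norm w * (norm x * norm y * norm (ip x y))"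
proof -
  have "norm (ip z x o\<^sub>L ip x y o\<^sub>L ip y w) \<le> norm (ip z x) * norm (ip x y) * norm (ip y w)"
    by (meson norm_blinfun_compose order_trans mult_right_mono norm_ge_zero)
  also have "\<dots> \<le> (norm z * norm x) * norm (ip x y) * (norm y * norm w)"
    by (intro mult_mono norm_ip_le) auto
  finally show ?thesis by (simp add: mult_ac)
qed

lemma norm_theta_le: "norm (theta act ip x y) \<le> norm x * norm y"
proof (rule norm_blinfun_bound)
  fix z
  show "norm (theta act ip x y z) \<le> norm x * norm y * norm z"
    unfolding theta_apply
    using norm_act_ip_le[of z y x] mult_right_mono[OF norm_ip_le[of z y], of "norm x"]
    by (simp add: mult_ac)
qed simp

text \<open>The lower bound comes from evaluation at \<open>x\<close>: \<open>\<langle>\<theta>\<^sub>x\<^sub>,\<^sub>x x, x\<rangle> = \<langle>x,x\<rangle>\<^sup>2\<close>, whose norm is \<open>\<parallel>x\<parallel>\<^sup>4\<close> by the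
  \<open>C*\<close>-identity for the self-adjoint operator \<open>\<langle>x,x\<rangle>\<close>.\<close>

lemma norm_theta_self: "norm (theta act ip x x) = (norm x)\<^sup>2"
proof (rule antisym)
  show "norm (theta act ip x x) \<le> (norm x)\<^sup>2"
    using norm_theta_le[of x x] by (simp add: power2_eq_square)
  let ?A = "ip x x" and ?a = "norm x"
  show "(norm x)\<^sup>2 \<le> norm (theta act ip x x)"
  proof (cases "x = 0")
    case False
    have "norm ?A \<le> sqrt (norm (?A o\<^sub>L ?A))"
    proof (rule norm_blinfun_bound)
      fix u
      have "(norm (?A u))\<^sup>2 = Re (cinner ((?A o\<^sub>L ?A) u) u)"
        using ip_adjoint[of x x] by (simp add: is_adjoint_def cinner_self)
      also have "\<dots> \<le> norm ((?A o\<^sub>L ?A) u) * norm u"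
        using complex_Re_le_cmod cinner_Cauchy_Schwarz order_trans by blast
      also have "\<dots> \<le> norm (?A o\<^sub>L ?A) * norm u * norm u"
        by (intro mult_right_mono norm_blinfun) simp
      also have "\<dots> = (sqrt (norm (?A o\<^sub>L ?A)) * norm u)\<^sup>2"
        by (simp add: power_mult_distrib power2_eq_square)
      finally show "norm (?A u) \<le> sqrt (norm (?A o\<^sub>L ?A)) * norm u"
        by (rule power2_le_imp_le) simp
    qed simp
    then have "?a\<^sup>2 \<le> sqrt (norm (?A o\<^sub>L ?A))" by (simp add: norm_ip_self)
    then have "(?a\<^sup>2)\<^sup>2 \<le> norm (?A o\<^sub>L ?A)"
      using power_mono[of "?a\<^sup>2" "sqrt (norm (?A o\<^sub>L ?A))" 2] by simp
    also have "?A o\<^sub>L ?A = ip (theta act ip x x x) x"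
      by (simp add: theta_apply ip_act ip_compact)
    also have "norm \<dots> \<le> norm (theta act ip x x x) * ?a" by (rule norm_ip_le)
    also have "\<dots> \<le> norm (theta act ip x x) * ?a * ?a"
      by (intro mult_right_mono norm_blinfun) simp
    finally have "?a\<^sup>2 * ?a\<^sup>2 \<le> norm (theta act ip x x) * ?a\<^sup>2"
      by (simp add: power2_eq_square mult.assoc)
    then show ?thesis using False by (intro mult_right_le_imp_le[of "?a\<^sup>2" "?a\<^sup>2"]) auto
  qed simp
qed

text \<open>The cross term at \<open>z\<close> is \<open>\<langle>\<langle>z,x\<rangle>x, \<langle>z,y\<rangle>y\<rangle> = \<langle>z,x\<rangle>\<langle>x,y\<rangle>\<langle>y,z\<rangle>\<close>, whose norm
  is at most \<open>\<parallel>x\<parallel>\<parallel>y\<parallel>\<parallel>\<langle>x,y\<rangle>\<parallel>\<parallel>z\<parallel>\<^sup>2\<close>.\<close>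

lemma norm_theta_add_squared_le:
  assumes "cmod l = 1"
  shows "(norm (theta act ip x x + l *\<^sub>C theta act ip y y))\<^sup>2
    \<le> norm x ^ 4 + norm y ^ 4 + 2 * (norm x * norm y * norm (ip x y))"
proof -
  let ?R = "norm x ^ 4 + norm y ^ 4 + 2 * (norm x * norm y * norm (ip x y))"
  have R: "?R \<ge> 0" by simp
  have "norm (theta act ip x x + l *\<^sub>C theta act ip y y) \<le> sqrt ?R"
  proof (rule norm_blinfun_bound)
    fix z
    let ?p = "theta act ip x x z" and ?q = "theta act ip y y z"
    have ip: "ip ?p ?q = ip z x o\<^sub>L ip x y o\<^sub>L ip y z"
      by (simp only: theta_apply ip_act[OF ip_compact] ip_act_right[OF ip_compact ip_adjoint]
         blinfun_compose_compose)
    have n: "(norm (theta act ip v v z))\<^sup>2 \<le> norm v ^ 4 * (norm z)\<^sup>2" for v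
      using power_mono[OF norm_blinfun[of "theta act ip v v" z] norm_ge_zero, of 2]
      by (simp add: norm_theta_self power_mult_distrib)
    have "(norm (?p + l *\<^sub>C ?q))\<^sup>2 \<le> (norm ?p)\<^sup>2 + (norm ?q)\<^sup>2 + 2 * norm (ip ?p ?q)"
      using norm_add_squared_le[of ?p "l *\<^sub>C ?q"] assms
      by (simp add: norm_scaleC ip_scaleC_right)
    also have "\<dots> \<le> ?R * (norm z)\<^sup>2"
      using n[of x] n[of y] norm_ip_sandwich_le[of z x y z]
      unfolding ip by (simp add: power2_eq_square algebra_simps)
    also have "\<dots> = (sqrt ?R * norm z)\<^sup>2" by (simp only: power_mult_distrib real_sqrt_pow2[OF R])
    finally have "norm (?p + l *\<^sub>C ?q) \<le> sqrt ?R * norm z"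
      by (rule power2_le_imp_le) (intro mult_nonneg_nonneg real_sqrt_ge_zero R norm_ge_zero)
    then show "norm ((theta act ip x x + l *\<^sub>C theta act ip y y) z) \<le> sqrt ?R * norm z"
      by (simp only: blinfun.add_left scaleC_blinfun.rep_eq)
  qed (rule real_sqrt_ge_zero[OF R])
  from power_mono[OF this norm_ge_zero, of 2] show ?thesis
    by (simp only: real_sqrt_pow2[OF R])
qed

section \<open>Parallelism and attainment of the bound for the inner product\<close>

lemma norm_parallel_imp_norm_ip:
  assumes "x \<parallel>\<^sub>n y"
  shows "norm (ip x y) = norm x * norm y"
proof -
  obtain l where l: "cmod l = 1" "norm (x + l *\<^sub>C y) = norm x + norm y"
    using assms by (auto simp: norm_parallel_def)
  have "(norm x + norm y)\<^sup>2 \<le> (norm x)\<^sup>2 + (norm y)\<^sup>2 + 2 * norm (ip x y)"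
    using norm_add_squared_le[of x "l *\<^sub>C y"] l by (simp add: norm_scaleC ip_scaleC_right)
  then have "norm x * norm y \<le> norm (ip x y)" by (simp add: power2_sum)
  then show ?thesis using norm_ip_le[of x y] by simp
qed

lemma theta_parallel_imp_norm_ip:
  assumes "theta act ip x x \<parallel>\<^sub>n theta act ip y y"
  shows "norm (ip x y) = norm x * norm y"
proof (cases "x = 0 \<or> y = 0")
  case True
  then show ?thesis using norm_ip_le[of x y] by auto
next
  case False
  then have ab: "norm x * norm y > 0" by simp
  obtain l where l: "cmod l = 1"
      "norm (theta act ip x x + l *\<^sub>C theta act ip y y) = (norm x)\<^sup>2 + (norm y)\<^sup>2"
    using assms by (auto simp: norm_parallel_def norm_theta_self)
  have "((norm x)\<^sup>2 + (norm y)\<^sup>2)\<^sup>2 \<le> norm x ^ 4 + norm y ^ 4 + 2 * (norm x * norm y * norm (ip x y))"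
    using norm_theta_add_squared_le[OF l(1), of x y] l(2) by simp
  then have "(norm x * norm y) * (norm x * norm y) \<le> (norm x * norm y) * norm (ip x y)"
    by (simp add: power2_eq_square power4_eq_xxxx algebra_simps)
  then have "norm x * norm y \<le> norm (ip x y)" by (rule mult_left_le_imp_le[OF _ ab])
  then show ?thesis using norm_ip_le[of x y] by simp
qed

text \<open>The scalar \<open>\<mu>/\<bar>\<mu>\<bar>\<close> turns the cross term at \<open>u\<close> into its modulus \<open>ab\<close>.\<close>

lemma norm_ip_imp_parallel:
  assumes normal: "normal_operator (ip x y)" and eq: "norm (ip x y) = norm x * norm y"
  shows "x \<parallel>\<^sub>n y"
proof (cases "x = 0 \<or> y = 0")
  case True
  then have "norm (x + 1 *\<^sub>C y) = norm x + norm y" by (auto simp: scaleC_one)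
  then show ?thesis unfolding norm_parallel_def by (intro exI[of _ 1]) simp
next
  case False
  then have xy: "x \<noteq> 0" "y \<noteq> 0" by auto
  obtain u \<mu> where u: "norm u = 1" "ip x y u = \<mu> *\<^sub>C u" "cmod \<mu> = norm x * norm y"
    "ip x x u = (complex_of_real ((norm x)\<^sup>2)) *\<^sub>C u" "ip y y u = (complex_of_real ((norm y)\<^sup>2)) *\<^sub>C u"
    using norm_attaining_eigenvector[OF xy normal eq] by metis
  define l where "l = \<mu> / cmod \<mu>"
  have "\<mu> \<noteq> 0" using u(3) xy by auto
  then have l: "cmod l = 1" by (simp add: l_def norm_divide)
  have "cnj l * \<mu> = complex_of_real (norm x * norm y)"
    unfolding u(3)[symmetric] l_def
    using \<open>\<mu> \<noteq> 0\<close> complex_norm_square[of \<mu>] by (simp add: field_simps power2_eq_square)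
  then have "Re (cinner (ip (x + l *\<^sub>C y) (x + l *\<^sub>C y) u) u) = (norm x + norm y)\<^sup>2"
    using u l by (simp add: cinner_ip_add_scaleC cinner_scaleC_left cinner_self power2_sum)
  then have "(norm x + norm y)\<^sup>2 \<le> (norm (x + l *\<^sub>C y))\<^sup>2"
    using cinner_ip_self_le[OF u(1), of "x + l *\<^sub>C y"] by simp
  then have "norm x + norm y \<le> norm (x + l *\<^sub>C y)" by (rule power2_le_imp_le) simp
  moreover have "norm (x + l *\<^sub>C y) \<le> norm x + norm y"
    using norm_triangle_ineq[of x "l *\<^sub>C y"] l by (simp add: norm_scaleC)
  ultimately show ?thesis using l by (auto simp: norm_parallel_def)
qed

text \<open>With \<open>e = u \<otimes> u\<close>, the operator \<open>\<theta>\<^sub>z\<^sub>,\<^sub>z\<close> sends \<open>ex\<close> to \<open>e\<langle>x,z\<rangle>z\<close>, a multiple of \<open>ez\<close> whenever \<open>u\<close> is an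
  eigenvector of \<open>\<langle>z,x\<rangle>\<close>.  For \<open>z = y\<close> proportionality of \<open>ey\<close> and \<open>ex\<close> leads back to \<open>ex\<close>, and both
  eigenvalues are positive, so the scalar in the definition of parallelism is 1.\<close>

lemma norm_ip_imp_theta_parallel:
  assumes normal: "normal_operator (ip x y)" and eq: "norm (ip x y) = norm x * norm y"
  shows "theta act ip x x \<parallel>\<^sub>n theta act ip y y"
proof -
  let ?S = "theta act ip x x + 1 *\<^sub>C theta act ip y y"
  have "(norm x)\<^sup>2 + (norm y)\<^sup>2 \<le> norm ?S"
  proof (cases "x = 0 \<or> y = 0")
    case True
    then have "theta act ip x x = 0 \<or> theta act ip y y = 0"
      using norm_theta_self[of x] norm_theta_self[of y] by auto
    then show ?thesis
      using norm_theta_self[of x] norm_theta_self[of y] True by (auto simp: scaleC_one)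
  next
    case False
    then have xy: "x \<noteq> 0" "y \<noteq> 0" by auto
    obtain u \<mu> where u: "norm u = 1" "ip x y u = \<mu> *\<^sub>C u" "ip y x u = cnj \<mu> *\<^sub>C u" "cmod \<mu> = norm x * norm y"
      "ip x x u = (complex_of_real ((norm x)\<^sup>2)) *\<^sub>C u" "ip y y u = (complex_of_real ((norm y)\<^sup>2)) *\<^sub>C u"
      "act (u \<otimes>\<^sub>H u) x = (\<mu> / (norm y)\<^sup>2) *\<^sub>C act (u \<otimes>\<^sub>H u) y"
      using norm_attaining_eigenvector[OF xy normal eq] by metis
    let ?e = "u \<otimes>\<^sub>H u"
    define p where "p = act ?e x"
    have theta_p: "theta act ip z z p = c *\<^sub>C act ?e z" if "ip z x u = cnj c *\<^sub>C u" for z c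
    proof -
      have "ip p z = c *\<^sub>C ?e"
        unfolding p_def ip_act[OF rank_one_compact]
        using rank_one_compose_eigenvector[OF ip_adjoint that] by simp
      then show ?thesis by (simp add: theta_apply act_scaleC_left rank_one_compact)
    qed
    have tx: "theta act ip x x p = complex_of_real ((norm x)\<^sup>2) *\<^sub>C p"
      using theta_p[of x "(norm x)\<^sup>2"] u by (simp add: p_def)
    have "theta act ip y y p = \<mu> *\<^sub>C act ?e y" using theta_p u by blast
    also have "\<dots> = complex_of_real ((norm y)\<^sup>2) *\<^sub>C p"
      unfolding p_def u(7) using xy by (simp add: scaleC_scaleC)
    finally have ty: "theta act ip y y p = complex_of_real ((norm y)\<^sup>2) *\<^sub>C p" .
    have "?S p = ((norm x)\<^sup>2 + (norm y)\<^sup>2) *\<^sub>R p"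
      by (simp only: blinfun.add_left scaleC_one tx ty scaleC_of_real scaleR_add_left)
    then have "((norm x)\<^sup>2 + (norm y)\<^sup>2) * norm p \<le> norm ?S * norm p"
      using norm_blinfun[of ?S p] by simp
    moreover have "p \<noteq> 0"
    proof
      assume "p = 0"
      then have "norm (ip p p) = 0" using ip_eq_zero_iff[of p] by simp
      then show False
        unfolding p_def ip_act_rank_one_self[OF u(5,1)]
        using xy u(1) by (simp add: norm_scaleC norm_rank_one_self norm_power)
    qed
    ultimately show ?thesis by simp
  qed
  moreover have "norm ?S \<le> (norm x)\<^sup>2 + (norm y)\<^sup>2"
    using norm_triangle_ineq[of "theta act ip x x" "theta act ip y y"]
    by (simp add: norm_theta_self scaleC_one)
  ultimately show ?thesis
    unfolding norm_parallel_def norm_theta_self by (intro exI[of _ 1]) simp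
qed

lemma basic_sequence_imp_norm_ip:
  fixes X :: "nat \<Rightarrow> 'e"
  assumes X: "\<And>n. norm (\<xi> n) = 1 \<and> ip (X n) (X n) = \<xi> n \<otimes>\<^sub>H \<xi> n"
    and l: "cmod l = 1"
    and lim: "(\<lambda>n. cinner ((ip (X n) x o\<^sub>L ip x y o\<^sub>L ip y (X n)) (\<xi> n)) (\<xi> n))
      \<longlonglongrightarrow> l * complex_of_real ((norm x)\<^sup>2 * (norm y)\<^sup>2)"
  shows "norm (ip x y) = norm x * norm y"
proof (cases "x = 0 \<or> y = 0")
  case True
  then show ?thesis using norm_ip_le[of x y] by auto
next
  case False
  then have ab: "norm x * norm y > 0" by simp
  define A where "A n = ip (X n) x o\<^sub>L ip x y o\<^sub>L ip y (X n)" for n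
  have bound: "cmod (cinner (A n (\<xi> n)) (\<xi> n)) \<le> norm x * norm y * norm (ip x y)" for n
  proof -
    have "(norm (X n))\<^sup>2 = 1\<^sup>2"
      using norm_ip_self[of "X n"] X[of n] by (simp add: norm_rank_one_self)
    then have "norm (X n) = 1" by (rule power2_eq_imp_eq) simp_all
    then have "norm (A n) \<le> norm x * norm y * norm (ip x y)"
      using norm_ip_sandwich_le[of "X n" x y "X n"] by (simp add: A_def)
    moreover have "cmod (cinner (A n (\<xi> n)) (\<xi> n)) \<le> norm (A n)"
      using cinner_Cauchy_Schwarz[of "A n (\<xi> n)" "\<xi> n"] norm_blinfun[of "A n" "\<xi> n"] X[of n] by simp
    ultimately show ?thesis by linarith
  qed
  have "cmod (l * complex_of_real ((norm x)\<^sup>2 * (norm y)\<^sup>2)) \<le> norm x * norm y * norm (ip x y)"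
    by (rule LIMSEQ_le_const2[OF tendsto_norm[OF lim[folded A_def]]]) (use bound in blast)
  then have "(norm x * norm y) * (norm x * norm y) \<le> (norm x * norm y) * norm (ip x y)"
    using l by (simp add: norm_mult norm_power power2_eq_square mult_ac)
  then have "norm x * norm y \<le> norm (ip x y)" by (rule mult_left_le_imp_le[OF _ ab])
  then show ?thesis using norm_ip_le[of x y] by simp
qed

lemma normal_operator_ip_self: "normal_operator (ip z z)"
  unfolding normal_operator_def adj_eqI[OF ip_adjoint] ..

text \<open>If \<open>x\<close> or \<open>y\<close> vanishes, the displayed number is 0 for every \<open>X\<close> and it only remains to find a basic
  vector; an eigenvector for the pair \<open>(z,z)\<close> with \<open>z \<noteq> 0\<close> provides one.\<close>

lemma norm_ip_imp_basic_vector: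
  assumes nontrivial: "\<exists>z::'e. z \<noteq> 0"
    and normal: "normal_operator (ip x y)" and eq: "norm (ip x y) = norm x * norm y"
  obtains X \<xi> where "basic_vector ip X" "norm \<xi> = 1" "ip X X = \<xi> \<otimes>\<^sub>H \<xi>"
    "cinner ((ip X x o\<^sub>L ip x y o\<^sub>L ip y X) \<xi>) \<xi> = complex_of_real ((norm x)\<^sup>2 * (norm y)\<^sup>2)"
proof (cases "x = 0 \<or> y = 0")
  case True
  obtain z :: 'e where z: "z \<noteq> 0" using nontrivial by blast
  have "norm (ip z z) = norm z * norm z" by (simp add: norm_ip_self power2_eq_square)
  then obtain u where u: "norm u = 1" "ip z z u = complex_of_real ((norm z)\<^sup>2) *\<^sub>C u"
    using norm_attaining_eigenvector[OF z z normal_operator_ip_self] by metis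
  have "ip x y = 0" using True eq by auto
  then have "cinner ((ip X x o\<^sub>L ip x y o\<^sub>L ip y X) u) u = complex_of_real ((norm x)\<^sup>2 * (norm y)\<^sup>2)" for X
    using True by (auto simp: cinner_zero_left)
  with basic_vector_of_eigenvector[OF u(2,1) z] u(1) that show thesis by blast
next
  case False
  then have xy: "x \<noteq> 0" "y \<noteq> 0" by auto
  obtain u \<mu> where u: "norm u = 1" "ip x y u = \<mu> *\<^sub>C u" "ip y x u = cnj \<mu> *\<^sub>C u" "cmod \<mu> = norm x * norm y"
    "ip x x u = (complex_of_real ((norm x)\<^sup>2)) *\<^sub>C u"
    using norm_attaining_eigenvector[OF xy normal eq] by metis
  let ?e = "u \<otimes>\<^sub>H u"
  define r where "r = complex_of_real (1 / norm x)"
  define X where "X = r *\<^sub>C act ?e x"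
  have lin: "ip a b (c *\<^sub>C v) = c *\<^sub>C ip a b v" for a b c v
    by (rule is_adjoint_scaleC[OF ip_adjoint])
  have e: "?e u = u" using u(1) by (simp add: rank_one_apply cinner_self scaleC_one)
  have eC: "?e (c *\<^sub>C v) = c *\<^sub>C ?e v" for c v
    by (rule is_adjoint_scaleC[OF is_adjoint_rank_one_self])
  have "ip y X u = (r * cnj \<mu>) *\<^sub>C u"
    unfolding X_def
    by (simp add: ip_scaleC_right ip_act_right[OF rank_one_compact is_adjoint_rank_one_self]
        scaleC_blinfun.rep_eq e u scaleC_scaleC r_def)
  moreover have "ip X x u = (r * (norm x)\<^sup>2) *\<^sub>C u"
    unfolding X_def
    by (simp add: ip_scaleC_left ip_act[OF rank_one_compact]
        scaleC_blinfun.rep_eq e eC u scaleC_scaleC)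
  ultimately have "(ip X x o\<^sub>L ip x y o\<^sub>L ip y X) u = (r * cnj \<mu> * (\<mu> * (r * (norm x)\<^sup>2))) *\<^sub>C u"
    by (simp add: lin u scaleC_scaleC mult.assoc)
  also have "r * cnj \<mu> * (\<mu> * (r * (norm x)\<^sup>2)) = \<mu> * cnj \<mu>"
    using xy by (simp add: r_def power2_eq_square)
  also have "\<dots> = complex_of_real ((norm x)\<^sup>2 * (norm y)\<^sup>2)"
    by (simp only: complex_norm_square[symmetric] u power_mult_distrib)
  finally have "cinner ((ip X x o\<^sub>L ip x y o\<^sub>L ip y X) u) u = complex_of_real ((norm x)\<^sup>2 * (norm y)\<^sup>2)"
    using u(1) by (simp add: cinner_scaleC_left cinner_self)
  with basic_vector_of_eigenvector[OF u(5,1) xy(1)] u(1) that show thesis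
    unfolding X_def r_def by blast
qed

end

theorem corollary3p10:
  fixes act :: "'h::chilbert_space operator \<Rightarrow> 'e::{complex_normed_vector,banach} \<Rightarrow> 'e"
    and ip :: "'e \<Rightarrow> 'e \<Rightarrow> 'h operator"
    and x y :: 'e
  assumes "compact_hilbert_module act ip"
    and nontrivial: "\<exists>z::'e. z \<noteq> 0"
    and "normal_operator (ip x y)"
  shows "(x \<parallel>\<^sub>n y \<longleftrightarrow> norm (ip x y) = norm x * norm y)
    \<and> (norm (ip x y) = norm x * norm y \<longleftrightarrow> theta act ip x x \<parallel>\<^sub>n theta act ip y y)
    \<and> (theta act ip x x \<parallel>\<^sub>n theta act ip y y \<longleftrightarrow>
        (\<exists>(X :: nat \<Rightarrow> 'e) (\<xi> :: nat \<Rightarrow> 'h) (l :: complex).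
          (\<forall>n. basic_vector ip (X n) \<and> norm (\<xi> n) = 1 \<and> ip (X n) (X n) = \<xi> n \<otimes>\<^sub>H \<xi> n) \<and>
          cmod l = 1 \<and>
          (\<lambda>n. cinner ((ip (X n) x o\<^sub>L ip x y o\<^sub>L ip y (X n)) (\<xi> n)) (\<xi> n))
            \<longlonglongrightarrow> l * complex_of_real ((norm x)\<^sup>2 * (norm y)\<^sup>2)))"
    (is "(?i \<longleftrightarrow> ?ii) \<and> (?ii \<longleftrightarrow> ?iii) \<and> (?iii \<longleftrightarrow> ?iv)")
proof -
  interpret compact_hilbert_module act ip by fact
  have "?i \<longleftrightarrow> ?ii" using norm_parallel_imp_norm_ip norm_ip_imp_parallel assms(3) by blast
  moreover have 23: "?ii \<longleftrightarrow> ?iii"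
    using theta_parallel_imp_norm_ip norm_ip_imp_theta_parallel assms(3) by blast
  moreover have "?ii \<longleftrightarrow> ?iv"
  proof
    assume ?ii
    then obtain X \<xi> where X: "basic_vector ip X" "norm \<xi> = 1" "ip X X = \<xi> \<otimes>\<^sub>H \<xi>"
      "cinner ((ip X x o\<^sub>L ip x y o\<^sub>L ip y X) \<xi>) \<xi> = complex_of_real ((norm x)\<^sup>2 * (norm y)\<^sup>2)"
      using norm_ip_imp_basic_vector[OF nontrivial assms(3)] by metis
    show ?iv
      using X by (intro exI[of _ "\<lambda>_. X"] exI[of _ "\<lambda>_. \<xi>"] exI[of _ 1]) simp
  next
    assume ?iv
    then show ?ii using basic_sequence_imp_norm_ip by blast
  qed
  ultimately show ?thesis by blast
qed

end
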